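(* If $H$ is a nonzero real Hilbert space, then $\zeta_H=1$.
   Context: For a real normed space $X$, $B_R(c)$ denotes the closed ball with center $c$ and radius $R>0$, $o$ is the origin, $\operatorname{co} D$ is the convex hull of $D$, and $\rho(x,A)=\inf_{a\in A}\|x-a\|$. The deviation of $A$ from $B$ is $h^{+}(A,B)=\sup_{x\in A}\rho(x,B)$. The CHD-constant (convex hull deviation constant) of $X$ is $\zeta_X=\sup h^{+}(\operatorname{co} D, D)$, where the supremum is over all nonempty sets $D\subset B_1(o)$. *)

theory Defs
  imports "HOL-Analysis.Analysis" "HOL-Library.Extended_Real"
begin

text \<open>Suprema are taken in \<^typ>\<open>ereal\<close>, where they always exist; on \<^typ>\<open>real\<close>,
  \<^const>\<open>Sup\<close> is unspecified on unbounded sets.\<close>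

text \<open>\<^const>\<open>infdist\<close> is the infimum of the distances only when \<open>B\<close> is nonempty
  (\<^prop>\<open>infdist x {} = 0\<close>), so \<open>B\<close> is meant to be nonempty.\<close>

definition deviation :: "'a::real_normed_vector set \<Rightarrow> 'a set \<Rightarrow> ereal" where
  "deviation A B = (SUP x\<in>A. ereal (infdist x B))"

text \<open>The space is the whole type and is passed as a type argument.\<close>

definition chd_constant :: "'a::real_normed_vector itself \<Rightarrow> ereal" where
  "chd_constant _ = (SUP D\<in>{D :: 'a set. D \<noteq> {} \<and> D \<subseteq> cball 0 1}. deviation (convex hull D) D)"

end

theory Submission
  imports Defs
begin

text \<open>The deviation never exceeds \<open>1\<close> because of a separation argument. If every point \<open>d\<close> of \<open>D\<close>
  were at distance more than \<open>1\<close> from \<open>y\<close>, then \<open>d\<close> would be closer to the origin than to \<open>y\<close>.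
  In an inner product space the points closer to the origin than to \<open>y\<close> form an open
  half-space, bounded by the perpendicular bisector (the empty set if \<open>y = 0\<close>). It is convex, so
  it would contain the hull of \<open>D\<close> as well, but it does not contain \<open>y\<close>. The value \<open>1\<close> is attained
  by an antipodal pair of unit vectors, whose midpoint is the origin.\<close>

lemma convex_hull_point_near:
  fixes D :: "'a::real_inner set"
  assumes D: "D \<subseteq> cball 0 r" and y: "y \<in> convex hull D"
  shows "\<exists>d\<in>D. dist y d \<le> r"
proof (rule ccontr)
  assume "\<not> ?thesis"
  then have far: "dist y d > r" if "d \<in> D" for d
    using that by force
  have "D \<subseteq> {d. y \<bullet> d < (y \<bullet> y) / 2}"
  proof
    fix d assume "d \<in> D"
    then have "norm d < norm (y - d)"
      using D far[of d] by (force simp: dist_norm)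
    then have "d \<bullet> d < (y - d) \<bullet> (y - d)"
      by (simp add: norm_lt)
    then show "d \<in> {d. y \<bullet> d < (y \<bullet> y) / 2}"
      by (simp add: inner_diff inner_commute)
  qed
  then have "convex hull D \<subseteq> {d. y \<bullet> d < (y \<bullet> y) / 2}"
    by (rule hull_minimal) (rule convex_halfspace_lt)
  then have "y \<bullet> y < (y \<bullet> y) / 2"
    using y by auto
  then show False
    using inner_ge_zero[of y] by linarith
qed

lemma deviation_convex_hull_le:
  fixes D :: "'a::real_inner set"
  assumes "D \<subseteq> cball 0 r"
  shows "deviation (convex hull D) D \<le> ereal r"
  unfolding deviation_def
proof (rule SUP_least)
  fix y assume "y \<in> convex hull D"
  then obtain d where "d \<in> D" "dist y d \<le> r"
    using convex_hull_point_near[OF assms] by blast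
  then show "ereal (infdist y D) \<le> ereal r"
    by (simp add: infdist_le2)
qed

lemma deviation_antipodal_ge:
  fixes e :: "'a::real_normed_vector"
  shows "ereal (norm e) \<le> deviation (convex hull {e, - e}) {e, - e}"
proof -
  have "midpoint e (- e) \<in> convex hull {e, - e}"
    by (metis midpoint_in_closed_segment segment_convex_hull)
  then have "0 \<in> convex hull {e, - e}"
    by (simp add: midpoint_def)
  moreover have "infdist 0 {e, - e} = norm e"
    by (simp add: infdist_def)
  ultimately show ?thesis
    unfolding deviation_def by (metis (no_types, lifting) SUP_upper)
qed

theorem corollary2:
  assumes "\<exists>x :: 'a :: {real_inner, complete_space}. x \<noteq> 0"
  shows "chd_constant TYPE('a) = 1"
proof (rule antisym)
  show "chd_constant TYPE('a) \<le> 1"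
    unfolding chd_constant_def one_ereal_def
    by (rule SUP_least) (simp add: deviation_convex_hull_le)
next
  obtain x :: 'a where "x \<noteq> 0"
    using assms by blast
  define e where "e = sgn x"
  have e: "norm e = 1"
    using \<open>x \<noteq> 0\<close> by (simp add: e_def norm_sgn)
  have "1 \<le> deviation (convex hull {e, - e}) {e, - e}"
    using deviation_antipodal_ge[of e] e by (simp add: one_ereal_def)
  also have "\<dots> \<le> chd_constant TYPE('a)"
    unfolding chd_constant_def by (rule SUP_upper) (simp add: e)
  finally show "1 \<le> chd_constant TYPE('a)" .
qed

end
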